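(* Let $n\ge3$, let $\mathbb{D}=\{z\in\mathbb{C}:|z|<1\}$ and let $\mathbb{B}^n$ be the open unit ball of $\mathbb{R}^n$. If $f:\mathbb{D}\to\mathbb{B}^n$ is a conformal harmonic map with $f(0)=0$, then $|f(z)|\le|z|$ holds for all $z\in\mathbb{D}$. Equality at one point $z\in\mathbb{D}\setminus\{0\}$ implies that $f$ is a conformal parameterization of a linear disc obtained by intersecting $\mathbb{B}^n$ with a (2-dimensional) plane through the origin, and hence equality holds at all points.
   Context: A map $f:\mathbb{D}\to\mathbb{R}^n$ is conformal harmonic if each component is a harmonic function and, with $z=x+iy$, $|f_x|=|f_y|$ and $f_x\cdot f_y=0$ at every point of $\mathbb{D}$ (points with $df=0$ are allowed). A conformal parameterization of a disc $\Sigma$ is a conformal diffeomorphism $\mathbb{D}\to\Sigma$, of either orientation. *)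

theory Defs
  imports "HOL-Analysis.Analysis"
begin

definition dir_deriv :: "'a::real_normed_vector \<Rightarrow> ('a \<Rightarrow> 'b::real_normed_vector) \<Rightarrow> 'a \<Rightarrow> 'b" where
  "dir_deriv v f = (\<lambda>x. frechet_derivative f (at x) v)"

text \<open>Class \<open>C\<^sup>k\<close>; intended for open \<open>S\<close>.\<close>

fun Ck_on :: "nat \<Rightarrow> ('a::euclidean_space \<Rightarrow> 'b::euclidean_space) \<Rightarrow> 'a set \<Rightarrow> bool" where
  "Ck_on 0 f S \<longleftrightarrow> continuous_on S f"
| "Ck_on (Suc k) f S \<longleftrightarrow>
     (\<forall>x\<in>S. f differentiable (at x)) \<and> (\<forall>v. Ck_on k (dir_deriv v f) S)"

text \<open>Smoothness on a set that need not be open (such as an embedded surface): near each point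
  the map is the restriction of a \<open>C\<^sup>\<infinity>\<close> map on an open subset of the ambient space.\<close>

definition smooth_on :: "('a::euclidean_space \<Rightarrow> 'b::euclidean_space) \<Rightarrow> 'a set \<Rightarrow> bool" where
  "smooth_on f S \<longleftrightarrow>
     (\<forall>p\<in>S. \<exists>U g. open U \<and> p \<in> U \<and> (\<forall>k. Ck_on k g U) \<and> (\<forall>x\<in>S \<inter> U. g x = f x))"

definition diffeomorphism_onto ::
    "('a::euclidean_space \<Rightarrow> 'b::euclidean_space) \<Rightarrow> 'a set \<Rightarrow> 'b set \<Rightarrow> bool" where
  "diffeomorphism_onto f S T \<longleftrightarrow>
     bij_betw f S T \<and> smooth_on f S \<and> smooth_on (inv_into S f) T"

text \<open>With \<open>z = x + \<i> y\<close>, the partial derivatives in \<open>x\<close> and \<open>y\<close> are the derivatives in the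
  directions \<open>1\<close> and \<open>\<i>\<close>.\<close>

definition harmonic_on :: "(complex \<Rightarrow> real) \<Rightarrow> complex set \<Rightarrow> bool" where
  "harmonic_on u S \<longleftrightarrow> Ck_on 2 u S \<and>
     (\<forall>z\<in>S. dir_deriv 1 (dir_deriv 1 u) z + dir_deriv \<i> (dir_deriv \<i> u) z = 0)"

text \<open>Points where the derivative vanishes are allowed.\<close>

definition weakly_conformal_on :: "(complex \<Rightarrow> real ^ 'n) \<Rightarrow> complex set \<Rightarrow> bool" where
  "weakly_conformal_on f S \<longleftrightarrow>
     (\<forall>z\<in>S. norm (dir_deriv 1 f z) = norm (dir_deriv \<i> f z) \<and>
             dir_deriv 1 f z \<bullet> dir_deriv \<i> f z = 0)"

definition conformal_harmonic_on :: "(complex \<Rightarrow> real ^ 'n) \<Rightarrow> complex set \<Rightarrow> bool" where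
  "conformal_harmonic_on f S \<longleftrightarrow>
     (\<forall>i. harmonic_on (\<lambda>z. f z $ i) S) \<and> weakly_conformal_on f S"

text \<open>No orientation condition is imposed. The derivative of a diffeomorphism is injective, so
  weak conformality is here conformality in the strict sense.\<close>

definition conformal_parameterization :: "(complex \<Rightarrow> real ^ 'n) \<Rightarrow> (real ^ 'n) set \<Rightarrow> bool" where
  "conformal_parameterization f \<Sigma> \<longleftrightarrow>
     diffeomorphism_onto f (ball 0 1) \<Sigma> \<and> weakly_conformal_on f (ball 0 1)"

end

theory Submission
  imports Defs
begin

text \<open>The heart of the matter is that \<open>ln |f|\<close> is subharmonic away from the zeros of a conformal harmonic
  map \<open>f\<close> (\<open>ln_norm_subharmonic\<close>). Indeed, with \<open>r = |f\<^sub>x| = |f\<^sub>y|\<close>, harmonicity gives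
  \<open>\<Delta> |f|\<^sup>2 = 4 r\<^sup>2\<close>, while \<open>|\<nabla> |f|\<^sup>2|\<^sup>2 = 4 (f \<bullet> f\<^sub>x)\<^sup>2 + 4 (f \<bullet> f\<^sub>y)\<^sup>2 \<le> 4 r\<^sup>2 |f|\<^sup>2\<close> because \<open>f\<^sub>x\<close>
  and \<open>f\<^sub>y\<close> are orthogonal of length \<open>r\<close>; together these say \<open>\<Delta> ln |f|\<^sup>2 \<ge> 0\<close>. So
  the difference \<open>ln |f| - ln |z|\<close> is subharmonic on the punctured disc. It is bounded above near the
  origin, as \<open>f\<close> is differentiable with \<open>f 0 = 0\<close>, and its upper limits at the unit circle are at
  most \<open>0\<close>. The maximum principle, with a small correction that takes care of the puncture, yields
  \<open>|f z| \<le> |z|\<close> (\<open>schwarz_inequality\<close>), just as in the classical Schwarz lemma.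

  If equality holds at one point other than the origin, the strong maximum principle spreads it over
  the disc (\<open>equality_everywhere\<close>). It is derived from Hopf's boundary point lemma
  (\<open>hopf_boundary_point\<close>), which rests on the second derivative test and a radial barrier.

  Once \<open>|f z| = |z|\<close> everywhere, comparing Laplacians of the squares gives \<open>r = 1\<close>, so all derivatives of
  \<open>f\<close> are isometric. The image of a radius is then a curve of unit speed whose distance from the
  origin also grows at unit speed, hence a straight segment, and \<open>f\<close> coincides with its derivative
  at the origin (\<open>equality_imp_linear\<close>). A linear isometry maps the unit disc conformally onto the
  intersection of the unit ball with a plane (\<open>linear_isometry_parameterizes_disc\<close>).\<close>

section \<open>First and second derivatives along lines\<close>

text \<open>Only one-variable calculus is used for the Laplacian: a function of \<open>z\<close> is restricted to the
  horizontal and the vertical line through a point. The first derivative has to exist on a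
  neighbourhood, or else the second one would not make sense.\<close>

definition second_order_jet :: "(real \<Rightarrow> real) \<Rightarrow> real \<Rightarrow> real \<Rightarrow> bool" where
  "second_order_jet h a p \<longleftrightarrow>
     (\<exists>h'. (\<forall>\<^sub>F t in nhds 0. (h has_real_derivative h' t) (at t)) \<and>
           h' 0 = a \<and> (h' has_real_derivative p) (at 0))"

lemma jetI:
  assumes "\<forall>\<^sub>F t in nhds 0. (h has_real_derivative h' t) (at t)"
    and "(h' has_real_derivative p) (at 0)"
  shows "second_order_jet h (h' 0) p"
  using assms unfolding second_order_jet_def by blast

lemma jet_add:
  assumes "second_order_jet g a p" "second_order_jet h b q"
  shows "second_order_jet (\<lambda>t. g t + h t) (a + b) (p + q)"
proof -
  obtain g' h' where *: "\<forall>\<^sub>F t in nhds 0. (g has_real_derivative g' t) (at t)"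
    "\<forall>\<^sub>F t in nhds 0. (h has_real_derivative h' t) (at t)" "g' 0 = a" "h' 0 = b"
    "(g' has_real_derivative p) (at 0)" "(h' has_real_derivative q) (at 0)"
    using assms unfolding second_order_jet_def by auto
  have "\<forall>\<^sub>F t in nhds 0. ((\<lambda>t. g t + h t) has_real_derivative g' t + h' t) (at t)"
    using *(1,2) by eventually_elim (rule DERIV_add)
  from jetI[OF this DERIV_add[OF *(5,6)]] show ?thesis
    using * by simp
qed

lemma jet_compose:
  assumes h: "second_order_jet h a p"
    and psi: "\<forall>\<^sub>F s in nhds (h 0). (\<psi> has_real_derivative \<psi>' s) (at s)"
    and psi': "(\<psi>' has_real_derivative d) (at (h 0))"
  shows "second_order_jet (\<lambda>t. \<psi> (h t)) (\<psi>' (h 0) * a) (d * a\<^sup>2 + \<psi>' (h 0) * p)"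
proof -
  obtain h' where h': "\<forall>\<^sub>F t in nhds 0. (h has_real_derivative h' t) (at t)"
    "h' 0 = a" "(h' has_real_derivative p) (at 0)"
    using h unfolding second_order_jet_def by auto
  have h0: "(h has_real_derivative a) (at 0)"
    using eventually_nhds_x_imp_x[OF h'(1)] h'(2) by simp
  then have "isCont h 0" by (rule DERIV_isCont)
  then have "filterlim h (nhds (h 0)) (nhds 0)"
    by (simp add: isCont_def tendsto_at_iff_tendsto_nhds)
  then have "\<forall>\<^sub>F t in nhds 0. (\<psi> has_real_derivative \<psi>' (h t)) (at (h t))"
    using psi by (rule eventually_compose_filterlim[rotated])
  then have 1: "\<forall>\<^sub>F t in nhds 0. ((\<lambda>t. \<psi> (h t)) has_real_derivative \<psi>' (h t) * h' t) (at t)"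
    using h'(1) by eventually_elim (rule DERIV_chain2)
  have "((\<lambda>t. \<psi>' (h t) * h' t) has_real_derivative d * a * h' 0 + p * \<psi>' (h 0)) (at 0)"
    by (rule DERIV_mult[OF DERIV_chain2[OF psi' h0] h'(3)])
  from jetI[OF 1 this] show ?thesis
    by (simp add: h' power2_eq_square algebra_simps)
qed

lemma jet_cmult:
  assumes "second_order_jet h a p"
  shows "second_order_jet (\<lambda>t. c * h t) (c * a) (c * p)"
proof -
  have "second_order_jet (\<lambda>t. c * h t) (c * a) (0 * a\<^sup>2 + c * p)"
    by (rule jet_compose[OF assms]) (auto intro!: derivative_eq_intros)
  then show ?thesis by simp
qed

lemma jet_unique:
  fixes g h :: "real \<Rightarrow> real"
  assumes g: "second_order_jet g a p" and h: "second_order_jet h b q"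
    and eq: "\<forall>\<^sub>F t in nhds 0. g t = h t"
  shows "a = b" "p = q"
proof -
  obtain g' h' where *: "\<forall>\<^sub>F t in nhds 0. (g has_real_derivative g' t) (at t)"
    "\<forall>\<^sub>F t in nhds 0. (h has_real_derivative h' t) (at t)" "g' 0 = a" "h' 0 = b"
    "(g' has_real_derivative p) (at 0)" "(h' has_real_derivative q) (at 0)"
    using g h unfolding second_order_jet_def by auto
  have "\<forall>\<^sub>F t in nhds 0. \<forall>\<^sub>F s in nhds t. g s = h s"
    using eq by (simp add: eventually_eventually)
  then have ev: "\<forall>\<^sub>F t in nhds 0. g' t = h' t"
    using *(1,2)
  proof eventually_elim
    case (elim t)
    then have "(h has_real_derivative g' t) (at t)"
      using DERIV_cong_ev[OF refl elim(1) refl, THEN iffD1] by blast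
    with elim show ?case using DERIV_unique by blast
  qed
  show "a = b" using eventually_nhds_x_imp_x[OF ev] * by simp
  have "(h' has_real_derivative p) (at 0)"
    using DERIV_cong_ev[OF refl ev refl] *(5) by simp
  then show "p = q" using *(6) DERIV_unique by blast
qed

text \<open>If the second derivative were positive, the first, which vanishes at a maximum, would be
  positive just to the right, so the function would increase there.\<close>

lemma jet_local_max:
  assumes h: "second_order_jet h a p" and max: "\<forall>\<^sub>F t in nhds 0. h t \<le> h 0"
  shows "p \<le> 0"
proof (rule ccontr)
  assume "\<not> p \<le> 0"
  then have p: "p > 0" by simp
  obtain h' where h': "\<forall>\<^sub>F t in nhds 0. (h has_real_derivative h' t) (at t)"
    "h' 0 = a" "(h' has_real_derivative p) (at 0)"
    using h unfolding second_order_jet_def by auto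
  obtain d where d: "d > 0"
    "\<And>t. \<bar>t\<bar> < d \<Longrightarrow> (h has_real_derivative h' t) (at t) \<and> h t \<le> h 0"
    using eventually_conj[OF h'(1) max] by (auto simp: eventually_nhds_metric dist_real_def)
  have "h' 0 = 0"
    by (rule DERIV_local_max[of h _ 0 d]) (use d in auto)
  obtain e where e: "e > 0" "\<And>t. 0 < t \<Longrightarrow> t < e \<Longrightarrow> h' 0 < h' t"
    using DERIV_pos_inc_right[OF h'(3) p] by auto
  define s where "s = min d e / 2"
  have s: "0 < s" "s < d" "s < e" using d e by (auto simp: s_def)
  obtain t where t: "0 < t" "t < s" "h s - h 0 = (s - 0) * h' t"
    using MVT2[of 0 s h h'] s d by auto
  have "h' t > 0" using e(2)[of t] t s \<open>h' 0 = 0\<close> by simp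
  then have "h s > h 0" using t s by (simp add: algebra_simps)
  with d(2)[of s] s show False by simp
qed

lemma jet_inner_self:
  fixes G :: "real \<Rightarrow> 'a::real_inner"
  assumes "\<forall>\<^sub>F t in nhds 0. (G has_vector_derivative G' t) (at t)"
    and G': "(G' has_vector_derivative G2) (at 0)"
  shows "second_order_jet (\<lambda>t. G t \<bullet> G t) (2 * (G 0 \<bullet> G' 0)) (2 * (G' 0 \<bullet> G' 0 + G 0 \<bullet> G2))"
proof -
  have 1: "\<forall>\<^sub>F t in nhds 0. ((\<lambda>t. G t \<bullet> G t) has_real_derivative 2 * (G t \<bullet> G' t)) (at t)"
    using assms(1)
    by eventually_elim
      (auto simp: has_vector_derivative_def has_field_derivative_def inner_commute algebra_simps
        intro!: derivative_eq_intros)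
  have "(G has_vector_derivative G' 0) (at 0)"
    using eventually_nhds_x_imp_x[OF assms(1)] .
  then have "((\<lambda>t. 2 * (G t \<bullet> G' t)) has_real_derivative 2 * (G' 0 \<bullet> G' 0 + G 0 \<bullet> G2)) (at 0)"
    using G' by (auto simp: has_vector_derivative_def has_field_derivative_def algebra_simps
        intro!: derivative_eq_intros)
  from jetI[OF 1 this] show ?thesis by simp
qed

section \<open>Gradient and Laplacian in the plane\<close>

text \<open>The gradient \<open>(a, b)\<close> is recorded next to the Laplacian \<open>L\<close> because both enter the Laplacian
  of a composition \<open>\<psi> \<circ> u\<close>, which is \<open>\<psi>''(u) (a\<^sup>2 + b\<^sup>2) + \<psi>'(u) L\<close>.\<close>
definition has_grad_lap :: "(complex \<Rightarrow> real) \<Rightarrow> complex \<Rightarrow> real \<Rightarrow> real \<Rightarrow> real \<Rightarrow> bool" where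
  "has_grad_lap u z a b L \<longleftrightarrow>
     (\<exists>p q. second_order_jet (\<lambda>t. u (z + t *\<^sub>R 1)) a p \<and>
            second_order_jet (\<lambda>t. u (z + t *\<^sub>R \<i>)) b q \<and> L = p + q)"

lemma has_grad_lap_add:
  assumes "has_grad_lap u z a b L" "has_grad_lap v z a' b' L'"
  shows "has_grad_lap (\<lambda>z. u z + v z) z (a + a') (b + b') (L + L')"
proof -
  obtain p q p' q' where *: "second_order_jet (\<lambda>t. u (z + t *\<^sub>R 1)) a p"
    "second_order_jet (\<lambda>t. u (z + t *\<^sub>R \<i>)) b q" "L = p + q"
    "second_order_jet (\<lambda>t. v (z + t *\<^sub>R 1)) a' p'"
    "second_order_jet (\<lambda>t. v (z + t *\<^sub>R \<i>)) b' q'" "L' = p' + q'"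
    using assms unfolding has_grad_lap_def by blast
  have "L + L' = (p + p') + (q + q')" using * by simp
  then show ?thesis
    unfolding has_grad_lap_def using jet_add[OF *(1,4)] jet_add[OF *(2,5)] by blast
qed

lemma has_grad_lap_cmult:
  assumes "has_grad_lap u z a b L"
  shows "has_grad_lap (\<lambda>z. c * u z) z (c * a) (c * b) (c * L)"
proof -
  obtain p q where *: "second_order_jet (\<lambda>t. u (z + t *\<^sub>R 1)) a p"
    "second_order_jet (\<lambda>t. u (z + t *\<^sub>R \<i>)) b q" "L = p + q"
    using assms unfolding has_grad_lap_def by blast
  have "c * L = c * p + c * q" using * by (simp add: algebra_simps)
  then show ?thesis
    unfolding has_grad_lap_def using jet_cmult[OF *(1)] jet_cmult[OF *(2)] by blast
qed

lemma has_grad_lap_compose: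
  assumes u: "has_grad_lap u z a b L"
    and psi: "\<forall>\<^sub>F s in nhds (u z). (\<psi> has_real_derivative \<psi>' s) (at s)"
    and psi': "(\<psi>' has_real_derivative d) (at (u z))"
  shows "has_grad_lap (\<lambda>z. \<psi> (u z)) z (\<psi>' (u z) * a) (\<psi>' (u z) * b)
           (d * (a\<^sup>2 + b\<^sup>2) + \<psi>' (u z) * L)"
proof -
  obtain p q where *: "second_order_jet (\<lambda>t. u (z + t *\<^sub>R 1)) a p"
    "second_order_jet (\<lambda>t. u (z + t *\<^sub>R \<i>)) b q" "L = p + q"
    using u unfolding has_grad_lap_def by blast
  have "d * (a\<^sup>2 + b\<^sup>2) + \<psi>' (u z) * L = (d * a\<^sup>2 + \<psi>' (u z) * p) + (d * b\<^sup>2 + \<psi>' (u z) * q)"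
    using * by (simp add: algebra_simps)
  then show ?thesis
    unfolding has_grad_lap_def
    using jet_compose[OF *(1), of \<psi> \<psi>' d] jet_compose[OF *(2), of \<psi> \<psi>' d] psi psi' by auto
qed

lemma tendsto_line: "filterlim (\<lambda>t. z + t *\<^sub>R v) (nhds (z::'a::real_normed_vector)) (nhds (0::real))"
proof -
  have "((\<lambda>t. z + t *\<^sub>R v) \<longlongrightarrow> z + 0 *\<^sub>R v) (nhds (0::real))"
    by (intro tendsto_intros filterlim_ident)
  then show ?thesis by simp
qed

lemma eventually_line:
  fixes z v :: "'a::real_normed_vector"
  assumes "\<forall>\<^sub>F x in nhds z. P x"
  shows "\<forall>\<^sub>F t in nhds (0::real). P (z + t *\<^sub>R v)"
  using tendsto_line[of z v] assms unfolding filterlim_iff by blast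

lemma has_grad_lap_unique:
  assumes "has_grad_lap u z a b L" "has_grad_lap v z a' b' L'" "\<forall>\<^sub>F x in nhds z. u x = v x"
  shows "a = a'" "b = b'" "L = L'"
  using assms(1,2) jet_unique[OF _ _ eventually_line[OF assms(3)]]
  unfolding has_grad_lap_def by metis+

lemma has_grad_lap_local_max:
  assumes "has_grad_lap u z a b L" "\<forall>\<^sub>F x in nhds z. u x \<le> u z"
  shows "L \<le> 0"
proof -
  obtain p q where *: "second_order_jet (\<lambda>t. u (z + t *\<^sub>R 1)) a p"
    "second_order_jet (\<lambda>t. u (z + t *\<^sub>R \<i>)) b q" "L = p + q"
    using assms unfolding has_grad_lap_def by blast
  have "p \<le> 0" using jet_local_max[OF *(1)] eventually_line[OF assms(2), of 1] by simp
  moreover have "q \<le> 0" using jet_local_max[OF *(2)] eventually_line[OF assms(2), of \<i>] by simp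
  ultimately show ?thesis using * by simp
qed

lemma has_grad_lap_ln:
  assumes u: "has_grad_lap u z a b L" and pos: "u z > 0"
  shows "has_grad_lap (\<lambda>z. ln (u z)) z (a / u z) (b / u z) (L / u z - (a\<^sup>2 + b\<^sup>2) / (u z)\<^sup>2)"
proof -
  have "\<forall>\<^sub>F s in nhds (u z). (ln has_real_derivative inverse s) (at s)"
    using eventually_nhds_in_open[of "{0<..}" "u z"] pos
    by (auto elim!: eventually_mono intro: DERIV_ln)
  moreover have "(inverse has_real_derivative - inverse ((u z)\<^sup>2)) (at (u z))"
    using pos by (auto intro!: derivative_eq_intros simp: power2_eq_square)
  ultimately have "has_grad_lap (\<lambda>z. ln (u z)) z (inverse (u z) * a) (inverse (u z) * b)
      (- inverse ((u z)\<^sup>2) * (a\<^sup>2 + b\<^sup>2) + inverse (u z) * L)"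
    by (rule has_grad_lap_compose[OF u])
  moreover have "- inverse ((u z)\<^sup>2) * (a\<^sup>2 + b\<^sup>2) + inverse (u z) * L = L / u z - (a\<^sup>2 + b\<^sup>2) / (u z)\<^sup>2"
    by (simp add: divide_inverse mult.commute)
  ultimately show ?thesis by (simp add: divide_inverse mult.commute)
qed

lemma has_grad_lap_dist_square:
  "has_grad_lap (\<lambda>z. (norm (z - c))\<^sup>2) z (2 * Re (z - c)) (2 * Im (z - c)) 4"
proof -
  have "second_order_jet (\<lambda>t. (z + t *\<^sub>R v - c) \<bullet> (z + t *\<^sub>R v - c))
      (2 * ((z + 0 *\<^sub>R v - c) \<bullet> v)) (2 * (v \<bullet> v + (z + 0 *\<^sub>R v - c) \<bullet> 0))" for v :: complex
    by (rule jet_inner_self)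
      (auto intro!: derivative_eq_intros always_eventually simp: has_vector_derivative_def)
  from this[of 1] this[of \<i>] show ?thesis
    unfolding has_grad_lap_def by (force simp: power2_norm_eq_inner inner_complex_def)
qed

text \<open>This is the fundamental harmonic function of the plane. Subtracting it from \<open>ln |f|\<^sup>2\<close> for
  \<open>c = 0\<close> turns \<open>|f|\<close> into the quotient \<open>|f| / |z|\<close> without affecting subharmonicity.\<close>

lemma has_grad_lap_ln_dist:
  assumes "z \<noteq> c"
  shows "\<exists>a b. has_grad_lap (\<lambda>z. ln ((norm (z - c))\<^sup>2)) z a b 0"
proof -
  define u where "u = (norm (z - c))\<^sup>2"
  have u: "u > 0" using assms by (simp add: u_def)
  have "(2 * Re (z - c))\<^sup>2 + (2 * Im (z - c))\<^sup>2 = 4 * u"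
    by (simp add: u_def cmod_power2 power_mult_distrib del: minus_complex.sel)
  then have "4 / u - ((2 * Re (z - c))\<^sup>2 + (2 * Im (z - c))\<^sup>2) / u\<^sup>2 = 0"
    using u by (simp add: power2_eq_square)
  then show ?thesis
    using has_grad_lap_ln[OF has_grad_lap_dist_square[of c z]] u unfolding u_def[symmetric] by metis
qed

text \<open>A radial function that is strictly subharmonic, hence a barrier for the boundary point lemma:
  it is constant on circles about \<open>c\<close> and strictly decreasing in the radius.\<close>

lemma has_grad_lap_inverse_dist:
  assumes "z \<noteq> c"
  shows "\<exists>a b. has_grad_lap (\<lambda>z. inverse ((norm (z - c))\<^sup>2)) z a b (4 / (norm (z - c))^4)"
proof -
  define u where "u = (norm (z - c))\<^sup>2"
  have u: "u > 0" using assms by (simp add: u_def)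
  have *: "(2 * Re (z - c))\<^sup>2 + (2 * Im (z - c))\<^sup>2 = 4 * u"
    by (simp add: u_def cmod_power2 power_mult_distrib del: minus_complex.sel)
  have "\<forall>\<^sub>F s in nhds u. (inverse has_real_derivative - inverse (s^2)) (at s)"
    using eventually_nhds_in_open[of "{0<..}" u] u
    by (auto elim!: eventually_mono intro!: derivative_eq_intros simp: power2_eq_square)
  moreover have "((\<lambda>s. - inverse (s^2)) has_real_derivative 2 / u^3) (at u)"
    using u by (auto intro!: derivative_eq_intros simp: power2_eq_square power3_eq_cube field_simps)
  ultimately have "has_grad_lap (\<lambda>z. inverse ((norm (z - c))\<^sup>2)) z (- inverse (u^2) * (2 * Re (z - c)))
      (- inverse (u^2) * (2 * Im (z - c))) (2 / u^3 * (4 * u) + - inverse (u^2) * 4)"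
    using has_grad_lap_compose[OF has_grad_lap_dist_square[where c=c and z=z], of inverse "\<lambda>s. - inverse (s^2)" "2 / u^3"] unfolding u_def[symmetric] * by blast
  moreover have "2 / u^3 * (4 * u) + - inverse (u^2) * 4 = 4 / u^2"
    using u by (simp add: field_simps power2_eq_square power3_eq_cube)
  moreover have "u^2 = (norm (z - c))^4" by (simp add: u_def)
  ultimately show ?thesis by auto
qed

section \<open>Subharmonicity of the logarithm of the norm\<close>

lemma has_vector_derivative_line:
  assumes "g differentiable (at (z + t *\<^sub>R v))"
  shows "((\<lambda>t. g (z + t *\<^sub>R v)) has_vector_derivative dir_deriv v g (z + t *\<^sub>R v)) (at t)"
proof -
  let ?D = "frechet_derivative g (at (z + t *\<^sub>R v))"
  have D: "(g has_derivative ?D) (at (z + t *\<^sub>R v))"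
    using assms frechet_derivative_works by blast
  have "((\<lambda>t. z + t *\<^sub>R v) has_derivative (\<lambda>h. h *\<^sub>R v)) (at t)"
    by (auto intro!: derivative_eq_intros)
  from has_derivative_compose[OF this D]
  have "((\<lambda>t. g (z + t *\<^sub>R v)) has_derivative (\<lambda>h. ?D (h *\<^sub>R v))) (at t)" .
  then show ?thesis
    unfolding has_vector_derivative_def dir_deriv_def
    by (simp add: linear_cmul[OF has_derivative_linear[OF D]])
qed

lemma differentiable_vec_iff:
  fixes g :: "'a::real_normed_vector \<Rightarrow> real ^ 'n"
  shows "g differentiable (at z) \<longleftrightarrow> (\<forall>i. (\<lambda>x. g x $ i) differentiable (at z))"
  unfolding differentiable_componentwise_within[of g z UNIV]
  by (auto simp: Basis_vec_def inner_axis)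

lemma dir_deriv_vec_nth:
  fixes g :: "'a::real_normed_vector \<Rightarrow> real ^ 'n"
  assumes "g differentiable (at z)"
  shows "dir_deriv v g z $ i = dir_deriv v (\<lambda>x. g x $ i) z"
proof -
  have "(g has_derivative frechet_derivative g (at z)) (at z)"
    using assms frechet_derivative_works by blast
  from bounded_linear.has_derivative[OF bounded_linear_vec_nth this, of i]
  show ?thesis unfolding dir_deriv_def using frechet_derivative_at by metis
qed

lemma eventually_in_disc:
  assumes "z \<in> ball 0 1"
  shows "\<forall>\<^sub>F x in nhds z. x \<in> ball (0::complex) 1"
  by (rule eventually_nhds_in_open) (use assms in auto)

text \<open>Bessel's inequality for two orthogonal vectors of equal length, scaled so that it also covers the
  case \<open>p = q = 0\<close> of a point where the derivative vanishes.\<close>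

lemma bessel_conformal:
  fixes w p q :: "'a::real_inner"
  assumes "norm p = norm q" "p \<bullet> q = 0"
  shows "(w \<bullet> p)\<^sup>2 + (w \<bullet> q)\<^sup>2 \<le> (norm p)\<^sup>2 * (norm w)\<^sup>2"
proof (cases "p = 0")
  case True
  then show ?thesis using assms by simp
next
  case False
  define r where "r = p \<bullet> p"
  have r: "r > 0" "q \<bullet> q = r" "q \<bullet> p = 0"
    using False assms by (auto simp: r_def norm_eq inner_commute)
  let ?e = "r *\<^sub>R w - (w \<bullet> p) *\<^sub>R p - (w \<bullet> q) *\<^sub>R q"
  have "0 \<le> ?e \<bullet> ?e" by simp
  also have "?e \<bullet> ?e = r * (r * (w \<bullet> w) - ((w \<bullet> p)\<^sup>2 + (w \<bullet> q)\<^sup>2))"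
    using assms(2) r r_def[symmetric]
    by (simp add: inner_diff_left inner_diff_right inner_commute power2_eq_square algebra_simps)
  finally have "0 \<le> r * (w \<bullet> w) - ((w \<bullet> p)\<^sup>2 + (w \<bullet> q)\<^sup>2)"
    using r by (simp add: zero_le_mult_iff)
  then show ?thesis
    by (simp add: power2_norm_eq_inner r_def)
qed

context
  fixes f :: "complex \<Rightarrow> real ^ 'n"
  assumes conf: "conformal_harmonic_on f (ball 0 1)"
begin

lemma conformal_harmonic_differentiable: "z \<in> ball 0 1 \<Longrightarrow> f differentiable (at z)"
  using conf unfolding conformal_harmonic_on_def harmonic_on_def differentiable_vec_iff
  by (simp add: numeral_2_eq_2)

lemma conformal_harmonic_continuous: "continuous_on (ball 0 1) f"
  by (meson conformal_harmonic_differentiable continuous_at_imp_continuous_on differentiable_imp_continuous_within)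

definition pure_second_deriv :: "complex \<Rightarrow> complex \<Rightarrow> real ^ 'n" where
  "pure_second_deriv v z = (\<chi> i. dir_deriv v (dir_deriv v (\<lambda>x. f x $ i)) z)"

lemma second_derivative_line:
  assumes "z \<in> ball 0 1"
  shows "((\<lambda>t. dir_deriv v f (z + t *\<^sub>R v)) has_vector_derivative pure_second_deriv v z) (at 0)"
proof -
  define F where "F x = (\<chi> i. dir_deriv v (\<lambda>x. f x $ i) x)" for x
  have F: "F differentiable (at z)"
    using conf assms unfolding conformal_harmonic_on_def harmonic_on_def differentiable_vec_iff F_def
    by (simp add: numeral_2_eq_2)
  have "dir_deriv v F z = pure_second_deriv v z"
    by (simp add: vec_eq_iff dir_deriv_vec_nth[OF F] pure_second_deriv_def) (simp add: F_def)
  then have "((\<lambda>t. F (z + t *\<^sub>R v)) has_vector_derivative pure_second_deriv v z) (at 0)"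
    using has_vector_derivative_line[of F z 0 v] F by simp
  moreover have ev: "\<forall>\<^sub>F t in nhds (0::real). F (z + t *\<^sub>R v) = dir_deriv v f (z + t *\<^sub>R v)"
    using eventually_line[OF eventually_in_disc[OF assms], of v]
    by (auto elim!: eventually_mono simp: F_def vec_eq_iff dir_deriv_vec_nth conformal_harmonic_differentiable)
  ultimately show ?thesis
    using has_vector_derivative_cong_ev[where x=0 and S=UNIV and f="\<lambda>t. F (z + t *\<^sub>R v)" and g="\<lambda>t. dir_deriv v f (z + t *\<^sub>R v)"]
      eventually_nhds_x_imp_x[OF ev] by simp
qed

text \<open>The terms \<open>f \<bullet> (f\<^sub>x\<^sub>x + f\<^sub>y\<^sub>y)\<close> cancel by harmonicity, and the remaining \<open>2 (|f\<^sub>x|\<^sup>2 + |f\<^sub>y|\<^sup>2)\<close>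
  is \<open>4 |f\<^sub>x|\<^sup>2\<close> by conformality.\<close>

lemma has_grad_lap_norm_square:
  assumes z: "z \<in> ball 0 1"
  shows "has_grad_lap (\<lambda>z. (norm (f z))\<^sup>2) z (2 * (f z \<bullet> dir_deriv 1 f z)) (2 * (f z \<bullet> dir_deriv \<i> f z))
           (4 * (norm (dir_deriv 1 f z))\<^sup>2)"
proof -
  have jet: "second_order_jet (\<lambda>t. f (z + t *\<^sub>R v) \<bullet> f (z + t *\<^sub>R v)) (2 * (f z \<bullet> dir_deriv v f z))
      (2 * (dir_deriv v f z \<bullet> dir_deriv v f z + f z \<bullet> pure_second_deriv v z))" for v
  proof -
    have "\<forall>\<^sub>F t in nhds 0. ((\<lambda>t. f (z + t *\<^sub>R v)) has_vector_derivative dir_deriv v f (z + t *\<^sub>R v)) (at t)"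
      using eventually_line[OF eventually_in_disc[OF z], of v]
      by (auto elim!: eventually_mono intro!: has_vector_derivative_line conformal_harmonic_differentiable)
    from jet_inner_self[OF this second_derivative_line[OF z]] show ?thesis by simp
  qed
  have "pure_second_deriv 1 z + pure_second_deriv \<i> z = 0"
    using conf z by (simp add: conformal_harmonic_on_def harmonic_on_def pure_second_deriv_def vec_eq_iff)
  then have "f z \<bullet> pure_second_deriv 1 z + f z \<bullet> pure_second_deriv \<i> z = 0"
    by (metis inner_add_right inner_zero_right)
  moreover have "dir_deriv 1 f z \<bullet> dir_deriv 1 f z = dir_deriv \<i> f z \<bullet> dir_deriv \<i> f z"
    using conf z by (simp add: conformal_harmonic_on_def weakly_conformal_on_def norm_eq)
  ultimately have "4 * (norm (dir_deriv 1 f z))\<^sup>2 =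
      2 * (dir_deriv 1 f z \<bullet> dir_deriv 1 f z + f z \<bullet> pure_second_deriv 1 z) +
      2 * (dir_deriv \<i> f z \<bullet> dir_deriv \<i> f z + f z \<bullet> pure_second_deriv \<i> z)"
    by (simp add: power2_norm_eq_inner)
  with jet[of 1] jet[of \<i>] show ?thesis
    unfolding has_grad_lap_def power2_norm_eq_inner by blast
qed

text \<open>With \<open>u = |f|\<^sup>2\<close> the Laplacian of \<open>ln u\<close> is
  \<open>4 (|f\<^sub>x|\<^sup>2 |f|\<^sup>2 - (f \<bullet> f\<^sub>x)\<^sup>2 - (f \<bullet> f\<^sub>y)\<^sup>2) / u\<^sup>2\<close>. Here conformality is essential: it makes
  \<open>f\<^sub>x\<close> and \<open>f\<^sub>y\<close> orthogonal of equal length, so that Bessel's inequality gives the sign. For a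
  general harmonic map \<open>ln |f|\<close> is not subharmonic.\<close>

lemma ln_norm_subharmonic:
  assumes z: "z \<in> ball 0 1" and nz: "f z \<noteq> 0"
  shows "\<exists>a b L. has_grad_lap (\<lambda>z. ln ((norm (f z))\<^sup>2)) z a b L \<and> L \<ge> 0"
proof -
  define u where "u = (norm (f z))\<^sup>2"
  define p q where "p = dir_deriv 1 f z" and "q = dir_deriv \<i> f z"
  have u: "u > 0" using nz by (simp add: u_def)
  have lap: "has_grad_lap (\<lambda>z. ln ((norm (f z))\<^sup>2)) z (2 * (f z \<bullet> p) / u) (2 * (f z \<bullet> q) / u)
      (4 * (norm p)\<^sup>2 / u - ((2 * (f z \<bullet> p))\<^sup>2 + (2 * (f z \<bullet> q))\<^sup>2) / u\<^sup>2)"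
    using has_grad_lap_ln[OF has_grad_lap_norm_square[OF z]] u
    unfolding u_def[symmetric] p_def[symmetric] q_def[symmetric] by blast
  have "(f z \<bullet> p)\<^sup>2 + (f z \<bullet> q)\<^sup>2 \<le> (norm p)\<^sup>2 * u"
    unfolding u_def p_def q_def using conf z
    by (intro bessel_conformal) (auto simp: conformal_harmonic_on_def weakly_conformal_on_def)
  then have "0 \<le> 4 * ((norm p)\<^sup>2 * u - ((f z \<bullet> p)\<^sup>2 + (f z \<bullet> q)\<^sup>2)) / u\<^sup>2"
    by simp
  also have "\<dots> = 4 * (norm p)\<^sup>2 / u - ((2 * (f z \<bullet> p))\<^sup>2 + (2 * (f z \<bullet> q))\<^sup>2) / u\<^sup>2"
    using u by (simp add: field_simps power2_eq_square)
  finally show ?thesis using lap by blast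
qed

lemma no_local_max:
  assumes p: "p \<in> ball 0 1" "f p \<noteq> 0" and H: "has_grad_lap H p a b L" "L > 0"
  shows "\<not> (\<forall>\<^sub>F x in nhds p. (norm (f x))\<^sup>2 * exp (H x) \<le> (norm (f p))\<^sup>2 * exp (H p))"
proof
  assume max: "\<forall>\<^sub>F x in nhds p. (norm (f x))\<^sup>2 * exp (H x) \<le> (norm (f p))\<^sup>2 * exp (H p)"
  obtain a' b' L' where L': "has_grad_lap (\<lambda>z. ln ((norm (f z))\<^sup>2)) p a' b' L'" "L' \<ge> 0"
    using ln_norm_subharmonic p by blast
  have "isCont f p" using conformal_harmonic_differentiable p differentiable_imp_continuous_within by blast
  then have "\<forall>\<^sub>F x in nhds p. f x \<noteq> 0"
    using p(2) by (simp add: isCont_def tendsto_at_iff_tendsto_nhds tendsto_imp_eventually_ne)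
  with max have "\<forall>\<^sub>F x in nhds p. ln ((norm (f x))\<^sup>2) + H x \<le> ln ((norm (f p))\<^sup>2) + H p"
  proof eventually_elim
    case (elim x)
    then have "ln ((norm (f x))\<^sup>2 * exp (H x)) \<le> ln ((norm (f p))\<^sup>2 * exp (H p))"
      using p by (subst ln_le_cancel_iff) auto
    then show ?case using elim p by (simp add: ln_mult)
  qed
  from has_grad_lap_local_max[OF has_grad_lap_add[OF L'(1) H(1)] this] L' H show False by simp
qed

text \<open>The product form \<open>|f|\<^sup>2 exp H\<close>, rather than \<open>ln |f|\<^sup>2 + H\<close>, keeps the function continuous at
  the zeros of \<open>f\<close>; the logarithm is only taken at a maximum with \<open>f p \<noteq> 0\<close>. Strict
  subharmonicity of \<open>H\<close> suffices to contradict the second derivative test.\<close>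

lemma maximum_principle:
  assumes K: "compact K" "K \<subseteq> ball 0 1"
    and cont: "continuous_on K (\<lambda>x. (norm (f x))\<^sup>2 * exp (H x))"
    and H: "\<And>p. p \<in> interior K \<Longrightarrow> f p \<noteq> 0 \<Longrightarrow> \<exists>a b L. has_grad_lap H p a b L \<and> L > 0"
    and bd: "\<And>p. p \<in> K - interior K \<Longrightarrow> (norm (f p))\<^sup>2 * exp (H p) \<le> M"
    and M: "M \<ge> 0" and z: "z \<in> K"
  shows "(norm (f z))\<^sup>2 * exp (H z) \<le> M"
proof -
  obtain p where p: "p \<in> K" and max: "\<And>x. x \<in> K \<Longrightarrow> (norm (f x))\<^sup>2 * exp (H x) \<le> (norm (f p))\<^sup>2 * exp (H p)"
    using continuous_attains_sup[OF K(1) _ cont] z by blast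
  have "(norm (f p))\<^sup>2 * exp (H p) \<le> M"
  proof (cases "p \<in> interior K \<and> f p \<noteq> 0")
    case True
    then have "\<forall>\<^sub>F x in nhds p. x \<in> interior K"
      by (intro eventually_nhds_in_open) auto
    then have "\<forall>\<^sub>F x in nhds p. (norm (f x))\<^sup>2 * exp (H x) \<le> (norm (f p))\<^sup>2 * exp (H p)"
      by eventually_elim (use max interior_subset in blast)
    with H[of p] True no_local_max[of p H] K(2) p show ?thesis by blast
  next
    case False
    then show ?thesis using bd[of p] p M by (cases "f p = 0") auto
  qed
  with max[OF z] show ?thesis by linarith
qed

section \<open>The Schwarz inequality\<close>

text \<open>The function \<open>|f|\<^sup>2 |z|\<^sup>-\<^sup>2\<close> is replaced by \<open>|f|\<^sup>2 |z|\<^bsup>-2r\<^esup> exp ((1 - r) |z|\<^sup>2)\<close>. The smaller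
  exponent makes it tend to \<open>0\<close> at the origin, because \<open>|f z|\<close> is bounded by a multiple of \<open>|z|\<close>;
  the exponential makes \<open>H\<close> strictly subharmonic. Both corrections disappear as the radius \<open>r\<close>
  tends to \<open>1\<close>. At the origin itself the value is \<open>0\<close>, since \<open>f 0 = 0\<close> and \<open>ln 0 = 0\<close>.\<close>

lemma schwarz_on_smaller_disc:
  assumes maps: "f ` ball 0 1 \<subseteq> ball 0 1" and f0: "f 0 = 0"
    and r: "0 < r" "r < 1" and z: "z \<in> ball 0 r"
  shows "(norm (f z))\<^sup>2 * exp (- r * ln ((norm z)\<^sup>2) + (1 - r) * (norm z)\<^sup>2)
           \<le> exp (- r * ln (r\<^sup>2) + (1 - r) * r\<^sup>2)"
proof -
  define H where "H x = - r * ln ((norm (x - 0))\<^sup>2) + (1 - r) * (norm (x - 0))\<^sup>2" for x :: complex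
  have Hc: "isCont H x" if "x \<noteq> 0" for x
    unfolding H_def using that by (intro continuous_intros) auto
  have fc: "isCont f x" if "x \<in> ball 0 1" for x
    using conformal_harmonic_differentiable[OF that] differentiable_imp_continuous_within by blast
  have c0: "((\<lambda>x. (norm (f x))\<^sup>2 * exp (H x)) \<longlongrightarrow> 0) (at 0)"
  proof -
    let ?D = "frechet_derivative f (at 0)"
    have D: "(f has_derivative ?D) (at 0)"
      using conformal_harmonic_differentiable[of 0] frechet_derivative_works by auto
    then obtain d where d: "d > 0" "\<And>x. norm x < d \<Longrightarrow> norm (f x - ?D x) \<le> norm x"
      unfolding has_derivative_at_alt using f0 by (force dest: spec[of _ 1])
    obtain B where B: "\<And>x. norm (?D x) \<le> norm x * B"
      using has_derivative_bounded_linear[OF D] bounded_linear.bounded by blast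
    have ev: "\<forall>\<^sub>F x in at 0. norm ((norm (f x))\<^sup>2 * exp (H x))
      \<le> (B + 1)\<^sup>2 * ((norm x)\<^sup>2 powr (1 - r) * exp ((1 - r) * (norm x)\<^sup>2))"
    proof -
      have "norm ((norm (f x))\<^sup>2 * exp (H x))
          \<le> (B + 1)\<^sup>2 * ((norm x)\<^sup>2 powr (1 - r) * exp ((1 - r) * (norm x)\<^sup>2))"
        if "x \<noteq> 0" "norm x < d" for x
      proof -
        have "norm (f x) \<le> norm (f x - ?D x) + norm (?D x)"
          by (metis diff_add_cancel norm_triangle_ineq)
        also have "\<dots> \<le> (B + 1) * norm x"
          using d(2)[OF that(2)] B[of x] by (simp add: algebra_simps)
        finally have "(norm (f x))\<^sup>2 \<le> ((B + 1) * norm x)\<^sup>2"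
          by (intro power_mono) auto
        then have "(norm (f x))\<^sup>2 * exp (H x) \<le> ((B + 1) * norm x)\<^sup>2 * exp (H x)"
          by (intro mult_right_mono) auto
        also have "\<dots> = (B + 1)\<^sup>2 * ((norm x)\<^sup>2 * exp (H x))"
          by (simp add: power_mult_distrib)
        also have "(norm x)\<^sup>2 * exp (H x) = (norm x)\<^sup>2 powr (1 - r) * exp ((1 - r) * (norm x)\<^sup>2)"
          using that by (simp add: H_def exp_add powr_def exp_diff exp_minus left_diff_distrib field_simps)
        finally show ?thesis by simp
      qed
      then show ?thesis using d(1) unfolding eventually_at by (metis dist_0_norm dist_commute)
    qed
    have "((\<lambda>x::complex. (norm x)\<^sup>2 powr (1 - r)) \<longlongrightarrow> 0) (at 0)"
      by (rule tendsto_zero_powrI[where b = "1 - r"])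
         (use r in \<open>auto intro!: tendsto_eq_intros\<close>)
    moreover have "((\<lambda>x::complex. exp ((1 - r) * (norm x)\<^sup>2)) \<longlongrightarrow> exp ((1 - r) * (norm (0::complex))\<^sup>2)) (at 0)"
      by (intro tendsto_intros)
    ultimately have "((\<lambda>x::complex. (norm x)\<^sup>2 powr (1 - r) * exp ((1 - r) * (norm x)\<^sup>2)) \<longlongrightarrow>
        0 * exp ((1 - r) * (norm (0::complex))\<^sup>2)) (at 0)"
      by (rule tendsto_mult)
    then have "((\<lambda>x::complex. (B + 1)\<^sup>2 * ((norm x)\<^sup>2 powr (1 - r) * exp ((1 - r) * (norm x)\<^sup>2))) \<longlongrightarrow> 0) (at 0)"
      by (intro tendsto_mult_right_zero) simp
    from Lim_null_comparison[OF ev this] show ?thesis .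
  qed
  have cont: "isCont (\<lambda>x. (norm (f x))\<^sup>2 * exp (H x)) x" if "x \<in> ball 0 1" for x
  proof (cases "x = 0")
    case True
    then show ?thesis using c0 f0 by (simp add: isCont_def)
  next
    case False
    then show ?thesis using fc[OF that] Hc by (intro continuous_intros) auto
  qed
  have sub: "cball 0 r \<subseteq> ball (0::complex) 1" using r by auto
  have "(norm (f z))\<^sup>2 * exp (H z) \<le> exp (- r * ln (r\<^sup>2) + (1 - r) * r\<^sup>2)"
  proof (rule maximum_principle[of "cball 0 r"])
    show "continuous_on (cball 0 r) (\<lambda>x. (norm (f x))\<^sup>2 * exp (H x))"
      using cont sub by (intro continuous_at_imp_continuous_on) blast
  next
    fix p assume p: "f p \<noteq> 0"
    with f0 have "p \<noteq> 0" by auto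
    from has_grad_lap_ln_dist[OF this] obtain a b where
      "has_grad_lap (\<lambda>x. ln ((norm (x - 0))\<^sup>2)) p a b 0" by blast
    from has_grad_lap_add[OF has_grad_lap_cmult[OF this] has_grad_lap_cmult[OF has_grad_lap_dist_square]]
    have "has_grad_lap H p (- r * a + (1 - r) * (2 * Re (p - 0)))
       (- r * b + (1 - r) * (2 * Im (p - 0))) (- r * 0 + (1 - r) * 4)"
      unfolding H_def .
    then show "\<exists>a b L. has_grad_lap H p a b L \<and> L > 0" using r by force
  next
    fix p :: complex assume "p \<in> cball 0 r - interior (cball 0 r)"
    then have p: "norm p = r" by (auto simp: interior_cball)
    then have "p \<in> ball 0 1" using r by simp
    then have "f p \<in> ball 0 1" using maps by blast
    then have "(norm (f p))\<^sup>2 \<le> 1" by (simp add: power_le_one)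
    then have "(norm (f p))\<^sup>2 * exp (H p) \<le> 1 * exp (H p)" by (intro mult_right_mono) auto
    then show "(norm (f p))\<^sup>2 * exp (H p) \<le> exp (- r * ln (r\<^sup>2) + (1 - r) * r\<^sup>2)"
      by (simp add: H_def p)
  qed (use sub z in auto)
  then show ?thesis by (simp add: H_def)
qed

lemma schwarz_inequality:
  assumes maps: "f ` ball 0 1 \<subseteq> ball 0 1" and f0: "f 0 = 0" and z: "z \<in> ball 0 1"
  shows "norm (f z) \<le> norm z"
proof (cases "z = 0")
  case True
  then show ?thesis using f0 by simp
next
  case False
  have "(norm (f z))\<^sup>2 * exp (- 1 * ln ((norm z)\<^sup>2) + (1 - 1) * (norm z)\<^sup>2)
           \<le> exp (- 1 * ln (1\<^sup>2) + (1 - 1) * 1\<^sup>2)"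
  proof (rule tendsto_le[where F = "at_left (1::real)"])
    show "((\<lambda>r::real. exp (- r * ln (r\<^sup>2) + (1 - r) * r\<^sup>2)) \<longlongrightarrow> exp (- 1 * ln (1\<^sup>2) + (1 - 1) * 1\<^sup>2)) (at_left 1)"
      by (intro tendsto_intros) auto
    show "((\<lambda>r::real. (norm (f z))\<^sup>2 * exp (- r * ln ((norm z)\<^sup>2) + (1 - r) * (norm z)\<^sup>2)) \<longlongrightarrow>
       (norm (f z))\<^sup>2 * exp (- 1 * ln ((norm z)\<^sup>2) + (1 - 1) * (norm z)\<^sup>2)) (at_left 1)"
      by (intro tendsto_intros)
    have "\<forall>\<^sub>F r in at_left (1::real). r \<in> {norm z<..<1}"
      using z by (intro eventually_at_left_real) auto
    then show "\<forall>\<^sub>F r in at_left (1::real).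
       (norm (f z))\<^sup>2 * exp (- r * ln ((norm z)\<^sup>2) + (1 - r) * (norm z)\<^sup>2) \<le> exp (- r * ln (r\<^sup>2) + (1 - r) * r\<^sup>2)"
    proof eventually_elim
      case (elim r)
      then have "norm z < r" "r < 1" by auto
      then have "0 < r" "r < 1" "z \<in> ball 0 r"
        using order.strict_trans1[OF norm_ge_zero] by auto
      from schwarz_on_smaller_disc[OF maps f0 this] show ?case .
    qed
  qed simp
  then have "(norm (f z))\<^sup>2 \<le> (norm z)\<^sup>2"
    using False by (simp add: exp_minus field_simps)
  then show ?thesis by (simp add: power2_le_iff_abs_le)
qed

section \<open>The case of equality\<close>

text \<open>Hopf's boundary point lemma for \<open>\<phi> = |f|\<^sup>2 / |z|\<^sup>2\<close>. Suppose that \<open>\<phi> < 1\<close> inside the disc and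
  \<open>\<phi> y = 1\<close> on its boundary. In the annulus between the radii \<open>R/2\<close> and \<open>R\<close>, comparison with the
  barrier forces \<open>\<phi>\<close> to fall off at least linearly as one moves inwards from \<open>y\<close>. But \<open>\<phi> \<le> 1\<close> near \<open>y\<close>,
  so \<open>y\<close> is an interior maximum of \<open>\<phi>\<close> and the derivative vanishes there.\<close>

lemma hopf_boundary_point:
  assumes bound: "\<And>z. z \<in> ball 0 1 \<Longrightarrow> norm (f z) \<le> norm z"
    and R: "R > 0" "cball c R \<subseteq> ball 0 1 - {0}"
    and strict: "\<And>x. x \<in> ball c R \<Longrightarrow> norm (f x) < norm x"
    and y: "dist c y = R"
  shows "norm (f y) < norm y"
proof (rule ccontr)
  assume "\<not> norm (f y) < norm y"
  moreover have yR: "y \<in> cball c R" using y by simp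
  ultimately have eq: "norm (f y) = norm y" using bound[of y] R(2) by fastforce
  define \<phi> where "\<phi> x = (norm (f x))\<^sup>2 / (norm x)\<^sup>2" for x
  have fc: "continuous_on (cball c R) f"
    using conformal_harmonic_continuous R(2) continuous_on_subset by blast
  have phic: "continuous_on (cball c R) \<phi>"
    unfolding \<phi>_def using R(2) by (intro continuous_intros fc) auto
  have phi_lt: "\<phi> x < 1" if "x \<in> ball c R" for x
  proof -
    have "x \<noteq> 0" using that R(2) ball_subset_cball[of c R] by blast
    then show ?thesis
      using strict[OF that] by (simp add: \<phi>_def divide_simps power_strict_mono)
  qed
  have phi_le: "\<phi> x \<le> 1" if "x \<in> ball 0 1" for x
    using bound[OF that] by (auto simp: \<phi>_def divide_simps intro!: power_mono)
  have "sphere c (R/2) \<noteq> {}" using R(1) by simp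
  moreover have sub2: "sphere c (R/2) \<subseteq> ball c R" using R(1) by (auto simp: dist_norm)
  ultimately obtain x0 where x0: "x0 \<in> sphere c (R/2)" "\<And>x. x \<in> sphere c (R/2) \<Longrightarrow> \<phi> x \<le> \<phi> x0"
    using continuous_attains_sup[of "sphere c (R/2)" \<phi>] continuous_on_subset[OF phic]
    by (metis (no_types, lifting) ball_subset_cball compact_sphere subset_trans)
  define m where "m = max (\<phi> x0) (1/2)"
  have m: "0 < m" "m < 1" "\<And>x. x \<in> sphere c (R/2) \<Longrightarrow> \<phi> x \<le> m"
    using phi_lt[of x0] x0 sub2 by (fastforce simp: m_def)+
  \<comment> \<open>With this \<open>e\<close> the weight \<open>exp (e R\<^sup>2 / |x - c|\<^sup>2)\<close>, equal to \<open>exp e\<close> on the outer circle and to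
    \<open>exp (4 e)\<close> on the inner one, gives the bound \<open>exp e\<close> for the weighted \<open>\<phi>\<close> on both circles.\<close>
  define e where "e = - ln m / 3"
  have e: "e > 0" "m * exp (4 * e) = exp e"
  proof -
    show "e > 0" using m by (simp add: e_def)
    have "m = exp (- 3 * e)" using m by (simp add: e_def)
    then have "m * exp (4 * e) = exp (- 3 * e) * exp (4 * e)" by simp
    also have "\<dots> = exp e" by (simp flip: exp_add)
    finally show "m * exp (4 * e) = exp e" .
  qed
  define H where "H x = - 1 * ln ((norm (x - 0))\<^sup>2) + (e * R\<^sup>2) * inverse ((norm (x - c))\<^sup>2)" for x :: complex
  have phiH: "(norm (f x))\<^sup>2 * exp (H x) = \<phi> x * exp (e * (R\<^sup>2 / (norm (x - c))\<^sup>2))" if "x \<noteq> 0" for x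
    using that by (simp add: H_def \<phi>_def exp_diff exp_minus exp_add field_simps)
  define K where "K = cball c R - ball c (R/2)"
  have K: "compact K" "K \<subseteq> cball c R"
    by (auto simp: K_def compact_diff)
  have Kne: "x \<noteq> 0" "x \<noteq> c" "x \<in> ball 0 1" if "x \<in> K" for x
  proof -
    show "x \<noteq> 0" "x \<in> ball 0 1" using that R(2) unfolding K_def by blast+
    show "x \<noteq> c" using that R(1) by (auto simp: K_def)
  qed
  have main: "\<phi> x * exp (e * (R\<^sup>2 / (norm (x - c))\<^sup>2)) \<le> exp e" if "x \<in> K" for x
  proof -
    have "(norm (f x))\<^sup>2 * exp (H x) \<le> exp e"
    proof (rule maximum_principle[OF K(1)])
      show "K \<subseteq> ball 0 1" using Kne by blast
      show "continuous_on K (\<lambda>x. (norm (f x))\<^sup>2 * exp (H x))"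
        unfolding H_def using Kne
        by (intro continuous_intros continuous_on_subset[OF fc K(2)]) auto
    next
      fix p assume "p \<in> interior K"
      then have p: "p \<in> K" using interior_subset by blast
      obtain a b where 1: "has_grad_lap (\<lambda>x. ln ((norm (x - 0))\<^sup>2)) p a b 0"
        using has_grad_lap_ln_dist[OF Kne(1)[OF p]] by blast
      obtain a' b' where 2: "has_grad_lap (\<lambda>x. inverse ((norm (x - c))\<^sup>2)) p a' b' (4 / (norm (p - c))^4)"
        using has_grad_lap_inverse_dist[OF Kne(2)[OF p]] by blast
      have "has_grad_lap H p (- 1 * a + (e * R\<^sup>2) * a') (- 1 * b + (e * R\<^sup>2) * b')
        (- 1 * 0 + (e * R\<^sup>2) * (4 / (norm (p - c))^4))"
        unfolding H_def by (intro has_grad_lap_add has_grad_lap_cmult 1 2)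
      moreover have "- 1 * 0 + (e * R\<^sup>2) * (4 / (norm (p - c))^4) > 0"
        using e R(1) Kne(2)[OF p] by simp
      ultimately show "\<exists>a b L. has_grad_lap H p a b L \<and> L > 0" by blast
    next
      fix p assume p: "p \<in> K - interior K"
      have "ball c R - cball c (R/2) \<subseteq> interior K"
        by (rule interior_maximal) (auto simp: K_def open_Diff)
      with p have "dist c p = R \<or> dist c p = R/2" by (force simp: K_def)
      then show "(norm (f p))\<^sup>2 * exp (H p) \<le> exp e"
      proof
        assume "dist c p = R"
        then have "norm (p - c) = R" by (simp add: dist_norm norm_minus_commute)
        then show ?thesis
          using phiH[of p] phi_le[of p] Kne[of p] p R(1) by simp
      next
        assume d: "dist c p = R/2"
        then have "R = 2 * norm (p - c)" by (simp add: dist_norm norm_minus_commute)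
        then have "R\<^sup>2 / (norm (p - c))\<^sup>2 = 4" using R(1) by (simp add: power_mult_distrib)
        then have "(norm (f p))\<^sup>2 * exp (H p) = \<phi> p * exp (4 * e)"
          using phiH[of p] Kne(1)[of p] p by (simp add: mult.commute)
        also have "\<dots> \<le> m * exp (4 * e)"
          using m(3)[of p] d by (intro mult_right_mono) auto
        finally show ?thesis using e by simp
      qed
    qed (use that in auto)
    then show ?thesis using phiH[OF Kne(1)[OF that]] by simp
  qed
  \<comment> \<open>On the radius from \<open>c\<close> to \<open>y\<close>, the bound has slope \<open>2 e\<close> at \<open>s = 1\<close>, whereas \<open>g\<close> has slope \<open>0\<close>.\<close>
  define g where "g s = \<phi> (c + s *\<^sub>R (y - c))" for s :: real
  have y1: "y \<in> ball 0 1" "y \<noteq> 0" using yR R(2) by blast+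
  have g1: "g 1 = 1" using eq y1 by (simp add: g_def \<phi>_def)
  have gle: "g s \<le> exp (e * (1 - 1 / s\<^sup>2))" if "1/2 \<le> s" "s \<le> 1" for s
  proof -
    have n: "norm (s *\<^sub>R (y - c)) = s * R"
      using y that by (simp add: dist_norm norm_minus_commute)
    have "c + s *\<^sub>R (y - c) \<in> K"
      using n that R(1) by (auto simp: K_def dist_norm mult_left_le_one_le)
    from main[OF this] have "g s * exp (e * (R\<^sup>2 / (s * R)\<^sup>2)) \<le> exp e"
      unfolding g_def add_diff_cancel_left' n .
    then have "g s * exp (e / s\<^sup>2) \<le> exp e"
      using R(1) by (simp add: power_mult_distrib)
    then show ?thesis by (simp add: exp_diff right_diff_distrib field_simps)
  qed
  have gd: "g differentiable (at 1)"
  proof -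
    have "((\<lambda>s. f (c + s *\<^sub>R (y - c))) has_vector_derivative dir_deriv (y - c) f (c + 1 *\<^sub>R (y - c))) (at 1)"
      using conformal_harmonic_differentiable[OF y1(1)] by (intro has_vector_derivative_line) simp
    then have "(\<lambda>s. f (c + s *\<^sub>R (y - c))) differentiable (at 1)"
      unfolding has_vector_derivative_def differentiable_def by blast
    then show ?thesis
      unfolding g_def \<phi>_def power2_norm_eq_inner using y1
      by (intro derivative_intros differentiable_divide) auto
  qed
  then obtain D where D: "(g has_real_derivative D) (at 1)"
    unfolding real_differentiable_def by blast
  have "\<forall>\<^sub>F s in nhds 1. c + s *\<^sub>R (y - c) \<in> ball 0 1"
  proof -
    have "((\<lambda>s. c + s *\<^sub>R (y - c)) \<longlongrightarrow> c + 1 *\<^sub>R (y - c)) (nhds (1::real))"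
      by (intro tendsto_intros filterlim_ident)
    moreover have "\<forall>\<^sub>F x in nhds y. x \<in> ball 0 1" using eventually_in_disc y1 by blast
    ultimately show ?thesis
      using eventually_compose_filterlim[of "\<lambda>x. x \<in> ball 0 1" "nhds y"] by simp
  qed
  then obtain d where "d > 0" "\<And>s. \<bar>1 - s\<bar> < d \<Longrightarrow> g s \<le> g 1"
    using phi_le g1 by (auto simp: g_def eventually_nhds_metric dist_real_def abs_minus_commute)
  from DERIV_local_max[OF D this(1)] this(2) have "D = 0" by blast
  have "((\<lambda>s. g s - exp (e * (1 - 1 / s\<^sup>2))) has_real_derivative - (2 * e)) (at 1)"
    using D \<open>D = 0\<close> by (auto intro!: derivative_eq_intros)
  from DERIV_neg_dec_left[OF this] e obtain d where d: "d > 0"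
    "\<And>h. h > 0 \<Longrightarrow> h < d \<Longrightarrow> g 1 - exp (e * (1 - 1 / 1\<^sup>2)) < g (1 - h) - exp (e * (1 - 1 / (1 - h)\<^sup>2))"
    by auto
  define h where "h = min d 1 / 2"
  have h: "0 < h" "h < d" "1/2 \<le> 1 - h" "1 - h \<le> 1" using d(1) by (auto simp: h_def)
  have "0 < g (1 - h) - exp (e * (1 - 1 / (1 - h)\<^sup>2))" using d(2)[OF h(1,2)] g1 by simp
  with gle[OF h(3,4)] show False by linarith
qed

text \<open>The set where equality holds is closed in the punctured disc. It is also open: from a point \<open>c\<close>
  near it but outside it, the largest disc about \<open>c\<close> that avoids it touches it at a point \<open>y\<close>, which
  the boundary point lemma rules out.\<close>

lemma equality_everywhere:
  assumes bound: "\<And>z. z \<in> ball 0 1 \<Longrightarrow> norm (f z) \<le> norm z"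
    and z0: "z0 \<in> ball 0 1 - {0}" "norm (f z0) = norm z0" and z: "z \<in> ball 0 1"
  shows "norm (f z) = norm z"
proof -
  define D :: "complex set" where "D = ball 0 1 - {0}"
  define Z where "Z = {z \<in> D. norm (f z) - norm z = 0}"
  have conn: "connected D" unfolding D_def by (rule connected_punctured_ball) simp
  have cD: "continuous_on D (\<lambda>z. norm (f z) - norm z)"
    unfolding D_def
    by (intro continuous_intros continuous_on_subset[OF conformal_harmonic_continuous]) auto
  then have clo: "closedin (top_of_set D) Z"
    unfolding Z_def by (rule continuous_closedin_preimage_constant)
  have "open Z"
    unfolding open_contains_ball
  proof
    fix w assume w: "w \<in> Z"
    have "open D" by (auto simp: D_def open_Diff)
    then obtain \<rho> where \<rho>: "\<rho> > 0" "cball w \<rho> \<subseteq> D"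
      using w unfolding open_contains_cball Z_def by blast
    have "ball w (\<rho>/2) \<subseteq> Z"
    proof (rule ccontr)
      assume "\<not> ball w (\<rho>/2) \<subseteq> Z"
      then obtain c where "c \<in> ball w (\<rho>/2)" and "c \<notin> Z" by blast
      then have c: "dist w c < \<rho>/2" "c \<notin> Z" by auto
      have "closed (cball w \<rho> \<inter> Z)"
      proof -
        have "closed {z \<in> cball w \<rho>. norm (f z) - norm z = 0}"
          by (rule continuous_closed_preimage_constant[OF continuous_on_subset[OF cD \<rho>(2)]]) simp
        also have "{z \<in> cball w \<rho>. norm (f z) - norm z = 0} = cball w \<rho> \<inter> Z"
          using \<rho>(2) by (auto simp: Z_def)
        finally show ?thesis .
      qed
      moreover have wZ: "w \<in> cball w \<rho> \<inter> Z" using w \<rho>(1) by simp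
      then have "cball w \<rho> \<inter> Z \<noteq> {}" by blast
      ultimately have "\<exists>y\<in>cball w \<rho> \<inter> Z. \<forall>x\<in>cball w \<rho> \<inter> Z. dist c y \<le> dist c x"
      proof (rule distance_attains_inf[of "cball w \<rho> \<inter> Z" c])
        fix y assume "y \<in> cball w \<rho> \<inter> Z" "\<And>x. x \<in> cball w \<rho> \<inter> Z \<Longrightarrow> dist c y \<le> dist c x"
        then show ?thesis by (intro bexI[of _ y] ballI)
      qed
      then obtain y where y: "y \<in> cball w \<rho> \<inter> Z" "\<And>x. x \<in> cball w \<rho> \<inter> Z \<Longrightarrow> dist c y \<le> dist c x"
        by blast
      \<comment> \<open>Since \<open>c\<close> is within \<open>\<rho>/2\<close> of \<open>w\<close>, the disc about \<open>c\<close> through \<open>y\<close> stays inside \<open>cball w \<rho>\<close>,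
        so minimality of \<open>y\<close> within \<open>cball w \<rho>\<close> is enough.\<close>
      have R: "dist c y > 0" "dist c y < \<rho>/2"
        using y(1) c y(2)[OF wZ] by (auto simp: dist_commute)
      have sub: "cball c (dist c y) \<subseteq> cball w \<rho>"
      proof
        fix x assume "x \<in> cball c (dist c y)"
        then show "x \<in> cball w \<rho>"
          using dist_triangle[of w x c] R c by simp
      qed
      have "norm (f y) < norm y"
      proof (rule hopf_boundary_point[OF bound R(1)])
        show "cball c (dist c y) \<subseteq> ball 0 1 - {0}" using sub \<rho> D_def by blast
        fix x assume x: "x \<in> ball c (dist c y)"
        then have "x \<in> cball c (dist c y)" by simp
        with sub have xw: "x \<in> cball w \<rho>" by (rule subsetD)
        have "x \<notin> Z"
        proof
          assume "x \<in> Z"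
          with xw have "dist c y \<le> dist c x" by (intro y(2) IntI)
          with x show False by simp
        qed
        moreover have "x \<in> D" using xw \<rho>(2) by (rule subsetD[rotated])
        ultimately have "x \<in> D" "norm (f x) \<noteq> norm x" by (auto simp: Z_def)
        with bound[of x] show "norm (f x) < norm x" by (simp add: D_def)
      qed simp_all
      with y(1) show False by (simp add: Z_def)
    qed
    then show "\<exists>e>0. ball w e \<subseteq> Z" using \<rho> by (intro exI[of _ "\<rho>/2"]) simp
  qed
  moreover have "Z \<subseteq> D" by (auto simp: Z_def)
  ultimately have "openin (top_of_set D) Z" by (simp add: open_subset)
  with clo have "Z = {} \<or> Z = D"
    using conn[unfolded connected_clopen, rule_format, of Z] by simp
  moreover have "z0 \<in> Z" using z0 by (simp add: Z_def D_def)
  ultimately have "Z = D" by blast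
  show ?thesis
  proof (cases "z = 0")
    case True
    then show ?thesis using bound[of 0] by simp
  next
    case False
    then have "z \<in> Z" using z unfolding \<open>Z = D\<close> D_def by simp
    then show ?thesis by (simp add: Z_def)
  qed
qed

text \<open>The functions \<open>|f|\<^sup>2\<close> and \<open>|z|\<^sup>2\<close> agree, hence so do their Laplacians \<open>4 |f\<^sub>x|\<^sup>2\<close> and \<open>4\<close>, and their
  gradients.\<close>

lemma isometric_derivative:
  assumes eq: "\<And>z. z \<in> ball 0 1 \<Longrightarrow> norm (f z) = norm z" and w: "w \<in> ball 0 1"
  shows "norm (dir_deriv \<zeta> f w) = norm \<zeta>" "f w \<bullet> dir_deriv \<zeta> f w = w \<bullet> \<zeta>"
proof -
  let ?p = "dir_deriv 1 f w" and ?q = "dir_deriv \<i> f w"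
  have "\<forall>\<^sub>F x in nhds w. (norm (f x))\<^sup>2 = (norm (x - 0))\<^sup>2"
    using eventually_in_disc[OF w] by eventually_elim (simp add: eq)
  note uniq = has_grad_lap_unique[OF has_grad_lap_norm_square[OF w] has_grad_lap_dist_square this]
  have "?p \<bullet> ?p = 1" using uniq(3) by (simp add: power2_norm_eq_inner)
  then have pq: "?p \<bullet> ?p = 1" "?q \<bullet> ?q = 1" "?p \<bullet> ?q = 0" "?q \<bullet> ?p = 0"
    using conf w by (auto simp: conformal_harmonic_on_def weakly_conformal_on_def norm_eq inner_commute)
  have D: "linear (frechet_derivative f (at w))"
    using conformal_harmonic_differentiable[OF w] by (rule linear_frechet_derivative)
  have "dir_deriv (Re \<zeta> *\<^sub>R 1 + Im \<zeta> *\<^sub>R \<i>) f w = Re \<zeta> *\<^sub>R ?p + Im \<zeta> *\<^sub>R ?q"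
    unfolding dir_deriv_def linear_add[OF D] linear_scale[OF D] ..
  moreover have "Re \<zeta> *\<^sub>R 1 + Im \<zeta> *\<^sub>R \<i> = \<zeta>" by (simp add: complex_eq_iff)
  ultimately have lin: "dir_deriv \<zeta> f w = Re \<zeta> *\<^sub>R ?p + Im \<zeta> *\<^sub>R ?q" by simp
  have "dir_deriv \<zeta> f w \<bullet> dir_deriv \<zeta> f w = \<zeta> \<bullet> \<zeta>"
    by (simp add: lin inner_add_left inner_add_right pq inner_complex_def)
  then show "norm (dir_deriv \<zeta> f w) = norm \<zeta>" by (simp add: norm_eq)
  show "f w \<bullet> dir_deriv \<zeta> f w = w \<bullet> \<zeta>"
    using uniq(1,2) by (simp add: lin inner_add_right inner_complex_def mult.commute)
qed

text \<open>The curve \<open>t \<mapsto> f (t z)\<close> has constant speed \<open>|z|\<close> and is at time \<open>t\<close> at distance \<open>t |z|\<close> from the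
  origin, where it starts. It must therefore be straight. In formulas, expanding
  \<open>|d/dt f (t z) - f (t z) / t|\<^sup>2\<close> with the previous lemma gives \<open>0\<close>, so \<open>f (t z) / t\<close> is constant on
  \<open>0 < t \<le> 1\<close>; its value at \<open>t = 1\<close> is \<open>f z\<close> and its limit at \<open>0\<close> is the derivative at the origin.\<close>

lemma equality_imp_linear:
  assumes eq: "\<And>z. z \<in> ball 0 1 \<Longrightarrow> norm (f z) = norm z" and z: "z \<in> ball 0 1"
  shows "f z = dir_deriv z f 0"
proof -
  have f0: "f 0 = 0" using eq[of 0] by simp
  have tz: "t *\<^sub>R z \<in> ball 0 1" if "t \<in> {0..1}" for t
    using z that by (simp add: mult_left_le_one_le le_less_trans[of _ "norm z"])
  have gd: "((\<lambda>t. f (0 + t *\<^sub>R z)) has_vector_derivative dir_deriv z f (0 + t *\<^sub>R z)) (at t)" if "t \<in> {0..1}" for t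
    using conformal_harmonic_differentiable[OF tz[OF that]] by (intro has_vector_derivative_line) simp
  have "((\<lambda>t. inverse t *\<^sub>R f (t *\<^sub>R z)) has_derivative (\<lambda>h. 0)) (at t within {0<..1})" if t: "t \<in> {0<..1}" for t
  proof -
    let ?g = "f (t *\<^sub>R z)" and ?g' = "dir_deriv z f (t *\<^sub>R z)"
    have b: "t *\<^sub>R z \<in> ball 0 1" using tz t by simp
    have "?g' \<bullet> ?g' = z \<bullet> z" "?g \<bullet> ?g = t\<^sup>2 * (z \<bullet> z)" "?g \<bullet> ?g' = t * (z \<bullet> z)"
      using isometric_derivative[OF eq b, of z] eq[OF b] t
      by (auto simp: norm_eq power2_eq_square simp flip: power2_norm_eq_inner)
    then have "(?g' - inverse t *\<^sub>R ?g) \<bullet> (?g' - inverse t *\<^sub>R ?g) = 0"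
      using t by (simp add: inner_diff_left inner_diff_right inner_commute power2_eq_square field_simps)
    then have g': "?g' = inverse t *\<^sub>R ?g" by simp
    have "((\<lambda>t. f (t *\<^sub>R z)) has_derivative (\<lambda>h. h *\<^sub>R ?g')) (at t within {0<..1})"
      using gd[of t] t by (auto simp: has_vector_derivative_def intro: has_derivative_at_withinI)
    then show ?thesis
      using t by (auto intro!: derivative_eq_intros simp: g' fun_eq_iff)
  qed
  then obtain k where k: "\<And>t. t \<in> {0<..1} \<Longrightarrow> inverse t *\<^sub>R f (t *\<^sub>R z) = k"
    using has_derivative_zero_constant[of "{0<..1}" "\<lambda>t. inverse t *\<^sub>R f (t *\<^sub>R z)"] by auto
  have "k = f z" using k[of 1] by simp
  have "((\<lambda>t. f (t *\<^sub>R z)) has_vector_derivative f z) (at 0 within {0..1})"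
    unfolding has_vector_derivative_def
  proof (rule has_derivative_transform)
    show "((\<lambda>t. t *\<^sub>R f z) has_derivative (\<lambda>x. x *\<^sub>R f z)) (at 0 within {0..1})"
      by (auto intro!: derivative_eq_intros)
    fix t :: real assume t: "t \<in> {0..1}"
    show "f (t *\<^sub>R z) = t *\<^sub>R f z"
    proof (cases "t = 0")
      case False
      have "t *\<^sub>R f z = t *\<^sub>R (inverse t *\<^sub>R f (t *\<^sub>R z))"
        using k[of t] \<open>k = f z\<close> t False by simp
      then show ?thesis using False by simp
    qed (simp add: f0)
  qed simp
  moreover have "((\<lambda>t. f (t *\<^sub>R z)) has_vector_derivative dir_deriv z f 0) (at 0 within {0..1})"
    using gd[of 0] by (auto intro: has_vector_derivative_at_within)
  ultimately show ?thesis
    using vector_derivative_unique_within_closed_interval[of 0 1 0] by auto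
qed

end

section \<open>Linear isometries parameterize linear discs\<close>

lemma Ck_on_const: "Ck_on k (\<lambda>x. c) S"
proof (induction k arbitrary: c)
  case (Suc k)
  have "dir_deriv v (\<lambda>x. c) = (\<lambda>x. 0)" for v :: 'a
    by (simp add: dir_deriv_def frechet_derivative_const)
  with Suc show ?case by simp
qed simp

lemma Ck_on_linear:
  assumes "linear L"
  shows "Ck_on k L S"
proof (cases k)
  case 0
  then show ?thesis using assms by (simp add: linear_continuous_on linear_conv_bounded_linear)
next
  case (Suc k)
  have d: "(L has_derivative L) (at x)" for x
    using assms by (simp add: linear_imp_has_derivative)
  then have "dir_deriv v L = (\<lambda>x. L v)" for v
    unfolding dir_deriv_def using frechet_derivative_at by metis
  with Suc d show ?thesis by (auto simp: Ck_on_const differentiable_def)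
qed

lemma smooth_on_linear:
  assumes "linear L" "\<And>x. x \<in> S \<Longrightarrow> f x = L x"
  shows "smooth_on f S"
  unfolding smooth_on_def
  using Ck_on_linear[OF assms(1), of _ UNIV] assms(2) by (metis IntD1 UNIV_I open_UNIV)

text \<open>The adjoint of a linear isometry is a left inverse of it defined on the whole space, so it
  provides the smooth extension of the inverse parameterization.\<close>

lemma linear_isometry_parameterizes_disc:
  fixes f :: "complex \<Rightarrow> real ^ 'n"
  assumes L: "linear L" "\<And>z. norm (L z) = norm z"
    and f: "\<And>z. z \<in> ball 0 1 \<Longrightarrow> f z = L z"
    and conf: "weakly_conformal_on f (ball 0 1)"
  shows "subspace (range L) \<and> dim (range L) = 2 \<and> conformal_parameterization f (ball 0 1 \<inter> range L)"
proof (intro conjI)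
  show "subspace (range L)" using L(1) by (simp add: linear_subspace_image)
  have inj: "inj L"
    unfolding linear_injective_0[OF L(1)]
  proof (intro allI impI)
    fix z assume "L z = 0"
    then show "z = 0" using L(2)[of z] by simp
  qed
  have "dim (range L) = dim (UNIV :: complex set)"
    using L(1) inj by (intro dim_image_eq) auto
  then show "dim (range L) = 2" by simp
  have inner_L: "L x \<bullet> L z = x \<bullet> z" for x z
    by (simp only: dot_norm linear_add[OF L(1), symmetric] L(2))
  have inv: "adjoint L (L z) = z" for z
  proof (rule vector_eq_ldot[THEN iffD1], rule allI)
    show "x \<bullet> adjoint L (L z) = x \<bullet> z" for x
      by (simp only: adjoint_works[OF L(1)] inner_L)
  qed
  have image: "f ` ball 0 1 = ball 0 1 \<inter> range L"
  proof -
    have "f ` ball 0 1 = L ` ball 0 1" using f by (rule image_cong[OF refl])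
    then show ?thesis by (auto simp: L(2))
  qed
  have injf: "inj_on f (ball 0 1)"
  proof (rule inj_onI)
    fix x y assume "x \<in> ball 0 1" "y \<in> ball 0 1" "f x = f y"
    then have "L x = L y" using f[of x] f[of y] by simp
    then show "x = y" by (rule injD[OF inj])
  qed
  have "inv_into (ball 0 1) f x = adjoint L x" if "x \<in> ball 0 1 \<inter> range L" for x
  proof -
    have "x \<in> f ` ball 0 1" using that unfolding image .
    then obtain z where z: "x = f z" "z \<in> ball 0 1" by (rule imageE)
    have "inv_into (ball 0 1) f x = z" unfolding z(1) using injf z(2) by (rule inv_into_f_f)
    moreover have "adjoint L x = z" unfolding z(1) f[OF z(2)] by (rule inv)
    ultimately show ?thesis by (rule trans[OF _ sym])
  qed
  then have "smooth_on (inv_into (ball 0 1) f) (ball 0 1 \<inter> range L)"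
    by (rule smooth_on_linear[OF adjoint_linear[OF L(1)]])
  moreover have "smooth_on f (ball 0 1)" by (rule smooth_on_linear[OF L(1) f])
  ultimately show "conformal_parameterization f (ball 0 1 \<inter> range L)"
    unfolding conformal_parameterization_def diffeomorphism_onto_def bij_betw_def
    by (intro conjI injf image conf)
qed

section \<open>The Schwarz lemma for conformal harmonic maps\<close>

theorem corollary2p7:
  fixes f :: "complex \<Rightarrow> real ^ 'n"
  assumes "CARD('n) \<ge> 3"
    and "f ` ball 0 1 \<subseteq> ball 0 1"
    and "conformal_harmonic_on f (ball 0 1)"
    and "f 0 = 0"
  shows "(\<forall>z\<in>ball 0 1. norm (f z) \<le> norm z) \<and>
    ((\<exists>z\<in>ball 0 1 - {0}. norm (f z) = norm z) \<longrightarrow>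
      (\<exists>P. subspace P \<and> dim P = 2 \<and> conformal_parameterization f (ball 0 1 \<inter> P)) \<and>
      (\<forall>z\<in>ball 0 1. norm (f z) = norm z))"
proof (intro conjI impI)
  note conf = assms(3)
  have bound: "norm (f z) \<le> norm z" if "z \<in> ball 0 1" for z
    using schwarz_inequality[OF conf assms(2,4) that] .
  then show "\<forall>z\<in>ball 0 1. norm (f z) \<le> norm z" by blast
  assume "\<exists>z\<in>ball 0 1 - {0}. norm (f z) = norm z"
  then have eq: "norm (f z) = norm z" if "z \<in> ball 0 1" for z
    using equality_everywhere[OF conf bound _ _ that] by blast
  then show "\<forall>z\<in>ball 0 1. norm (f z) = norm z" by blast
  define L where "L z = dir_deriv z f 0" for z
  have "linear L"
    unfolding L_def dir_deriv_def
    using linear_frechet_derivative[OF conformal_harmonic_differentiable[OF conf, of 0]] by simp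
  moreover have "norm (L z) = norm z" for z
    unfolding L_def by (rule isometric_derivative(1)[OF conf eq]) auto
  moreover have "f z = L z" if "z \<in> ball 0 1" for z
    unfolding L_def by (rule equality_imp_linear[OF conf eq that])
  moreover have "weakly_conformal_on f (ball 0 1)"
    using conf by (simp add: conformal_harmonic_on_def)
  ultimately show "\<exists>P. subspace P \<and> dim P = 2 \<and> conformal_parameterization f (ball 0 1 \<inter> P)"
    using linear_isometry_parameterizes_disc by blast
qed

end
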